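(* Let $\lambda$ be a nonzero real number. For all integers $n\ge 0$ and $p\ge -1$, $$\beta_{n,\lambda}^{(p)}=\sum_{k=0}^{n}\frac{\lambda^{k}(1)_{k+1,1/\lambda}}{\binom{p+k+1}{p+1}}\,S_{2,\lambda}(n,k).$$
   Context: For real $\mu$ and $x$: $(x)_{0,\mu}=1$ and $(x)_{n,\mu}=x(x-\mu)(x-2\mu)\cdots(x-(n-1)\mu)$ for $n\ge 1$; thus $(1)_{k+1,1/\lambda}$ is this symbol with $x=1$, $\mu=1/\lambda$. Also $(x)_0=1$, $(x)_n=x(x-1)\cdots(x-n+1)$ for $n\ge1$, and $\langle a\rangle_0=1$, $\langle a\rangle_k=a(a+1)\cdots(a+k-1)$ for $k\ge1$. The degenerate exponential is the formal power series $e_\lambda^x(t)=\sum_{n\ge0}(x)_{n,\lambda}\frac{t^n}{n!}$, with $e_\lambda(t)=e_\lambda^1(t)$. The degenerate Stirling numbers of the second kind $S_{2,\lambda}(n,k)$ ($0\le k\le n$) are defined by $(x)_{n,\lambda}=\sum_{k=0}^{n}S_{2,\lambda}(n,k)(x)_k$ for $n\ge 0$; equivalently $\frac{1}{k!}(e_\lambda(t)-1)^k=\sum_{n\ge k}S_{2,\lambda}(n,k)\frac{t^n}{n!}$. The Gauss hypergeometric series is ${}_2F_1(a,b;c;x)=\sum_{k\ge0}\frac{\langle a\rangle_k\langle b\rangle_k}{\langle c\rangle_k}\frac{x^k}{k!}$. For an integer $p\ge-1$, the generalized degenerate Bernoulli numbers $\beta_{n,\lambda}^{(p)}$ ($n\ge0$)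 are defined by the identity of formal power series in $t$ (note $1-e_\lambda(t)$ has zero constant term) $${}_2F_1\big(1-\lambda,1;p+2;1-e_\lambda(t)\big)=\sum_{n=0}^\infty\beta_{n,\lambda}^{(p)}\frac{t^n}{n!}.$$ *)

theory Defs
  imports Complex_Main "HOL-Computational_Algebra.Formal_Power_Series"
begin

definition deg_ffact :: "real \<Rightarrow> real \<Rightarrow> nat \<Rightarrow> real" where
  "deg_ffact \<mu> x n = (\<Prod>i<n. x - real i * \<mu>)"

definition ffact :: "real \<Rightarrow> nat \<Rightarrow> real" where
  "ffact x n = (\<Prod>i<n. x - real i)"

definition deg_exp :: "real \<Rightarrow> real \<Rightarrow> real fps" where
  "deg_exp lam x = Abs_fps (\<lambda>n. deg_ffact lam x n / fact n)"

text \<open>The degenerate Stirling numbers of the second kind are the connection coefficients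
  between the two families of falling factorials. They are only meaningful for \<open>k \<le> n\<close>;
  they are set to zero for \<open>k > n\<close>, which makes the description unique
  (lemma \<open>ex1_deg_Stirling2\<close>).\<close>

definition is_deg_Stirling2 :: "real \<Rightarrow> (nat \<Rightarrow> nat \<Rightarrow> real) \<Rightarrow> bool" where
  "is_deg_Stirling2 lam S \<longleftrightarrow>
     (\<forall>n x. deg_ffact lam x n = (\<Sum>k\<le>n. S n k * ffact x k)) \<and>
     (\<forall>n k. n < k \<longrightarrow> S n k = 0)"

definition deg_Stirling2 :: "real \<Rightarrow> nat \<Rightarrow> nat \<Rightarrow> real" where
  "deg_Stirling2 lam = (THE S. is_deg_Stirling2 lam S)"

text \<open>The generating function of the generalized degenerate Bernoulli numbers. Since
  \<open>1 - deg_exp lam 1\<close> has zero constant term, the composition is the intended substitution.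
  The parameter is meant to satisfy \<open>p \<ge> -1\<close>, so that \<open>p + 2\<close> is a positive integer.\<close>

definition deg_Bernoulli_gf :: "real \<Rightarrow> int \<Rightarrow> real fps" where
  "deg_Bernoulli_gf lam p =
     fps_compose (fps_hypergeo [1 - lam, 1] [of_int p + 2] 1) (1 - deg_exp lam 1)"

definition deg_Bernoulli :: "real \<Rightarrow> int \<Rightarrow> nat \<Rightarrow> real" where
  "deg_Bernoulli lam p n = fact n * fps_nth (deg_Bernoulli_gf lam p) n"

lemma deg_Bernoulli_gf_eq:
  "deg_Bernoulli_gf lam p = Abs_fps (\<lambda>n. deg_Bernoulli lam p n / fact n)"
  by (simp add: fps_eq_iff deg_Bernoulli_def)

lemma one_minus_deg_exp_nth_0: "fps_nth (1 - deg_exp lam 1) 0 = 0"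
  by (simp add: deg_exp_def deg_ffact_def)

lemma hypergeo_2F1_nth:
  "fps_nth (fps_hypergeo [a, b] [c :: real] 1) k =
     pochhammer a k * pochhammer b k / pochhammer c k / fact k"
  by simp

lemma ffact_eq_deg_ffact: "ffact x n = deg_ffact 1 x n"
  by (simp add: ffact_def deg_ffact_def)

fun stirling_rec :: "real \<Rightarrow> nat \<Rightarrow> nat \<Rightarrow> real" where
  "stirling_rec lam 0 k = (if k = 0 then 1 else 0)"
| "stirling_rec lam (Suc n) k =
     (if k = 0 then 0 else stirling_rec lam n (k - 1)) +
     (real k - real n * lam) * stirling_rec lam n k"

lemma stirling_rec_eq_0: "n < k \<Longrightarrow> stirling_rec lam n k = 0"
  by (induction n arbitrary: k) auto

lemma deg_ffact_stirling_rec: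
  "deg_ffact lam x n = (\<Sum>k\<le>n. stirling_rec lam n k * ffact x k)"
proof (induction n)
  case 0
  show ?case by (simp add: deg_ffact_def ffact_def)
next
  case (Suc n)
  let ?s = "stirling_rec lam n"
  have shift: "(x - real n * lam) * ffact x k = ffact x (Suc k) + (real k - real n * lam) * ffact x k" for k
    by (simp add: ffact_def algebra_simps)
  have "deg_ffact lam x (Suc n) = (\<Sum>k\<le>n. ?s k * ((x - real n * lam) * ffact x k))"
    using Suc by (simp add: deg_ffact_def sum_distrib_left mult_ac)
  also have "\<dots> = (\<Sum>k\<le>n. ?s k * ffact x (Suc k)) +
      (\<Sum>k\<le>n. (real k - real n * lam) * ?s k * ffact x k)"
    unfolding shift by (simp add: distrib_left sum.distrib mult_ac)
  also have "(\<Sum>k\<le>n. ?s k * ffact x (Suc k)) =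
      (\<Sum>k\<le>Suc n. (if k = 0 then 0 else ?s (k - 1)) * ffact x k)"
    by (subst sum.atMost_Suc_shift) simp
  also have "(\<Sum>k\<le>n. (real k - real n * lam) * ?s k * ffact x k) =
      (\<Sum>k\<le>Suc n. (real k - real n * lam) * ?s k * ffact x k)"
    by (simp add: stirling_rec_eq_0)
  finally show ?case
    by (simp only: sum.distrib [symmetric] distrib_right [symmetric] stirling_rec.simps)
qed

lemma ffact_of_nat_eq_0: "m < k \<Longrightarrow> ffact (real m) k = 0"
  by (auto simp: ffact_def intro!: prod_zero)

lemma ffact_of_nat_self: "ffact (real m) m \<noteq> 0"
  by (auto simp: ffact_def)

lemma ffact_coeffs_unique:
  assumes "\<And>x. (\<Sum>k\<le>n. a k * ffact x k) = (\<Sum>k\<le>n. b k * ffact x k)" and "m \<le> n"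
  shows "a m = b m"
  using \<open>m \<le> n\<close>
proof (induction m rule: less_induct)
  case (less m)
  have split: "(\<Sum>k\<le>n. c k * ffact (real m) k) =
      c m * ffact (real m) m + (\<Sum>k<m. c k * ffact (real m) k)" for c
  proof -
    have "(\<Sum>k\<le>n. c k * ffact (real m) k) = (\<Sum>k\<le>m. c k * ffact (real m) k)"
      using less.prems by (intro sum.mono_neutral_right) (auto simp: ffact_of_nat_eq_0)
    then show ?thesis by (simp flip: lessThan_Suc_atMost)
  qed
  have "(\<Sum>k<m. a k * ffact (real m) k) = (\<Sum>k<m. b k * ffact (real m) k)"
    using less by (intro sum.cong) auto
  then show ?case
    using assms(1)[of "real m"] ffact_of_nat_self[of m] by (simp add: split)
qed

lemma ex1_deg_Stirling2: "\<exists>!S. is_deg_Stirling2 lam S"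
proof (rule ex1I)
  show "is_deg_Stirling2 lam (stirling_rec lam)"
    using deg_ffact_stirling_rec stirling_rec_eq_0 by (simp add: is_deg_Stirling2_def)
next
  fix S assume S: "is_deg_Stirling2 lam S"
  show "S = stirling_rec lam"
  proof (intro ext)
    fix n k
    show "S n k = stirling_rec lam n k"
    proof (cases "k \<le> n")
      case True
      have "(\<Sum>k\<le>n. S n k * ffact x k) = (\<Sum>k\<le>n. stirling_rec lam n k * ffact x k)" for x
        using S deg_ffact_stirling_rec unfolding is_deg_Stirling2_def by metis
      from ffact_coeffs_unique[OF this True] show ?thesis .
    next
      case False
      then show ?thesis using S by (simp add: is_deg_Stirling2_def stirling_rec_eq_0)
    qed
  qed
qed

lemma is_deg_Stirling2_deg_Stirling2: "is_deg_Stirling2 lam (deg_Stirling2 lam)"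
  unfolding deg_Stirling2_def by (rule theI'[OF ex1_deg_Stirling2])

end

theory Submission
  imports Defs
begin

text \<open>Expand the hypergeometric series in powers of \<open>e - 1\<close>, where \<open>e = deg_exp lam 1\<close>.
  Up to the factor \<open>fact k\<close>, the power \<open>(e - 1) ^ k\<close> is the exponential generating function
  of the degenerate Stirling numbers: the differential equation \<open>(1 + lam * t) * e' = e\<close>
  turns into their triangular recurrence.\<close>

lemma deg_Stirling2_eq_stirling_rec: "deg_Stirling2 lam = stirling_rec lam"
proof -
  have "is_deg_Stirling2 lam (stirling_rec lam)"
    using deg_ffact_stirling_rec stirling_rec_eq_0 by (simp add: is_deg_Stirling2_def)
  with ex1_deg_Stirling2 is_deg_Stirling2_deg_Stirling2 show ?thesis by blast
qed

text \<open>Consecutive falling factorials differ by the factor \<open>x - n * lam\<close>. Moving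
  the part with \<open>n * lam\<close> to the left produces the summand
  \<open>lam * t * e'\<close>.\<close>

lemma deg_exp_deriv:
  "(1 + fps_const lam * fps_X) * fps_deriv (deg_exp lam x) = fps_const x * deg_exp lam x"
proof (rule fps_ext)
  fix n
  have "real (Suc n) * fps_nth (deg_exp lam x) (Suc n) = (x - real n * lam) * fps_nth (deg_exp lam x) n"
    by (simp add: deg_exp_def deg_ffact_def del: of_nat_Suc)
  then show "fps_nth ((1 + fps_const lam * fps_X) * fps_deriv (deg_exp lam x)) n =
      fps_nth (fps_const x * deg_exp lam x) n"
    by (cases n) (simp_all add: distrib_right mult.assoc, simp_all add: algebra_simps)
qed

text \<open>With \<open>E = e - 1\<close>, the equation \<open>(1 + lam * t) * E' = E + 1\<close>
  gives \<open>(1 + lam * t) * (E ^ k)' = k * (E ^ k + E ^ (k - 1))\<close> for positive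
  \<open>k\<close>. The coefficients of \<open>t ^ n\<close> express column \<open>k\<close> at
  \<open>n + 1\<close> through columns \<open>k\<close> and \<open>k - 1\<close> at
  \<open>n\<close>, so \<open>k\<close> stays arbitrary in the induction;
  \<open>k * fact (k - 1) = fact k\<close> absorbs the extra factor.\<close>

lemma deg_exp_minus_one_power_nth:
  "fact n * fps_nth ((deg_exp lam 1 - 1) ^ k) n = fact k * stirling_rec lam n k"
proof (induction n arbitrary: k)
  case 0
  show ?case by (cases k) (simp_all add: fps_nth_power_0 deg_exp_def deg_ffact_def)
next
  case (Suc n)
  define E where "E = deg_exp lam 1 - 1"
  have E': "(1 + fps_const lam * fps_X) * fps_deriv E = E + 1"
    using deg_exp_deriv[of lam 1] by (simp add: E_def)
  show ?case
  proof (cases k)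
    case 0
    then show ?thesis
      \<comment> \<open>The recurrence multiplies \<open>stirling_rec lam n 0\<close> by
        \<open>- n * lam\<close>. This factor vanishes for \<open>n = 0\<close>; for positive
        \<open>n\<close> the induction hypothesis makes the number itself vanish.\<close>
      by (cases n) (use Suc.IH[of 0] in \<open>auto\<close>)
  next
    case (Suc j)
    have "(1 + fps_const lam * fps_X) * fps_deriv (E ^ k) =
        fps_const (real k) * ((1 + fps_const lam * fps_X) * fps_deriv E) * E ^ j"
      by (simp only: Suc fps_deriv_power diff_Suc_1 ac_simps)
    also have "\<dots> = fps_const (real k) * (E ^ k + E ^ j)"
      unfolding E' by (simp add: Suc algebra_simps)
    finally have "fps_nth ((1 + fps_const lam * fps_X) * fps_deriv (E ^ k)) n =
        real k * (fps_nth (E ^ k) n + fps_nth (E ^ j) n)"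
      by simp
    moreover have "fps_nth ((1 + fps_const lam * fps_X) * fps_deriv (E ^ k)) n =
        real (Suc n) * fps_nth (E ^ k) (Suc n) + lam * real n * fps_nth (E ^ k) n"
      by (cases n) (simp_all add: distrib_right mult.assoc del: power_Suc)
    ultimately have rec: "real (Suc n) * fps_nth (E ^ k) (Suc n) =
        (real k - lam * real n) * fps_nth (E ^ k) n + real k * fps_nth (E ^ j) n"
      by (simp add: algebra_simps)
    have "fact (Suc n) * fps_nth (E ^ k) (Suc n) =
        fact n * (real (Suc n) * fps_nth (E ^ k) (Suc n))"
      by (simp add: algebra_simps)
    also have "\<dots> = (real k - lam * real n) * (fact n * fps_nth (E ^ k) n) +
        real k * (fact n * fps_nth (E ^ j) n)"
      unfolding rec by (simp add: algebra_simps)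
    also have "\<dots> = (real k - lam * real n) * (fact k * stirling_rec lam n k) +
        real k * (fact j * stirling_rec lam n j)"
      using Suc.IH[of k] Suc.IH[of j] by (simp add: E_def)
    also have "\<dots> = fact k * stirling_rec lam (Suc n) k"
      by (simp add: Suc algebra_simps)
    finally show ?thesis by (simp add: E_def)
  qed
qed

text \<open>The sign turns each factor \<open>i - lam\<close>, for \<open>i\<close> from 1 to
  \<open>k\<close>, into \<open>lam - i = lam * (1 - i / lam)\<close>. The index
  \<open>k + 1\<close> on the right arises from the additional factor for \<open>i = 0\<close>,
  which is 1.\<close>

lemma pochhammer_one_minus:
  fixes lam :: real
  assumes "lam \<noteq> 0"
  shows "(- 1) ^ k * pochhammer (1 - lam) k = lam ^ k * deg_ffact (1 / lam) 1 (k + 1)"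
proof (induction k)
  case 0
  show ?case by (simp add: deg_ffact_def)
next
  case (Suc k)
  have "(- 1) ^ Suc k * pochhammer (1 - lam) (Suc k) =
      (lam - real (Suc k)) * ((- 1) ^ k * pochhammer (1 - lam) k)"
    by (simp add: pochhammer_Suc algebra_simps)
  also have "\<dots> = lam ^ Suc k * ((1 - real (Suc k) * (1 / lam)) * deg_ffact (1 / lam) 1 (k + 1))"
    unfolding Suc.IH using assms by (simp add: field_simps)
  also have "(1 - real (Suc k) * (1 / lam)) * deg_ffact (1 / lam) 1 (k + 1) =
      deg_ffact (1 / lam) 1 (Suc k + 1)"
    by (simp add: deg_ffact_def)
  finally show ?case .
qed

text \<open>The rising factorial from \<open>m + 1\<close> is the quotient of
  \<open>fact (m + k)\<close> by \<open>fact m\<close>.\<close>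

lemma fact_divide_pochhammer:
  "fact k / pochhammer (real m + 1) k = 1 / real ((m + k) choose m)"
proof -
  have "(fact (m + k) :: real) = fact m * pochhammer (real m + 1) k"
    using pochhammer_product'[of "1 :: real" m k] by (simp add: pochhammer_fact add.commute)
  then show ?thesis
    by (simp add: binomial_fact field_simps)
qed

theorem theorem3:
  fixes lam :: real and n :: nat and p :: int
  assumes "lam \<noteq> 0" and "p \<ge> -1"
  shows "deg_Bernoulli lam p n =
    (\<Sum>k\<le>n. lam ^ k * deg_ffact (1 / lam) 1 (k + 1)
        / real (nat (p + int k + 1) choose nat (p + 1))
        * deg_Stirling2 lam n k)"
proof -
  \<comment> \<open>As \<open>p\<close> is at least -1, the lower parameter \<open>p + 2\<close> is
    \<open>m + 1\<close> for a natural number \<open>m\<close>.\<close>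
  define m where "m = nat (p + 1)"
  have p: "p = int m - 1" using assms(2) by (simp add: m_def)
  have "1 - deg_exp lam 1 = fps_const (- 1) * (deg_exp lam 1 - 1)"
    by (simp flip: fps_const_neg)
  then have pow: "(1 - deg_exp lam 1) ^ k = fps_const ((- 1) ^ k) * (deg_exp lam 1 - 1) ^ k" for k
    by (simp only: power_mult_distrib fps_const_power)
  \<comment> \<open>The upper parameter 1 contributes \<open>pochhammer 1 k = fact k\<close>, which
    cancels the factorial in the hypergeometric coefficient.\<close>
  have "deg_Bernoulli lam p n =
      (\<Sum>k\<le>n. pochhammer (1 - lam) k / pochhammer (real m + 1) k *
        ((- 1) ^ k * (fact n * fps_nth ((deg_exp lam 1 - 1) ^ k) n)))"
    by (simp add: deg_Bernoulli_def deg_Bernoulli_gf_def fps_compose_nth p pow sum_distrib_left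
        atLeast0AtMost pochhammer_fact [symmetric] ac_simps)
  also have "\<dots> = (\<Sum>k\<le>n. (- 1) ^ k * pochhammer (1 - lam) k *
      (fact k / pochhammer (real m + 1) k) * stirling_rec lam n k)"
    unfolding deg_exp_minus_one_power_nth by (simp add: ac_simps)
  also have "\<dots> = (\<Sum>k\<le>n. lam ^ k * deg_ffact (1 / lam) 1 (k + 1)
      / real ((m + k) choose m) * stirling_rec lam n k)"
    unfolding fact_divide_pochhammer pochhammer_one_minus[OF assms(1)] by simp
  finally show ?thesis
    by (simp add: deg_Stirling2_eq_stirling_rec p nat_int_add)
qed

end
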